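(* For every integer $k \ge 0$ there is a graph $G$ such that $\gamma_s(G) - \gamma_s(\mu(G)) = k$.
   Context: All graphs are finite, simple, connected, undirected, with nonempty vertex set (in particular the graph $G$ in the claim is connected). A set $S\subseteq V(G)$ is a dominating set of $G$ if every vertex of $V(G)\setminus S$ is adjacent to some vertex of $S$. A dominating set $S$ is a secure dominating set of $G$ if for every $u\in V(G)\setminus S$ there is $v\in S$ adjacent to $u$ such that $(S\setminus\{v\})\cup\{u\}$ is a dominating set of $G$. The secure domination number $\gamma_s(G)$ is the minimum cardinality of a secure dominating set of $G$. For a graph $G$ with vertices $v_1,\dots,v_n$, the Mycielskian $\mu(G)$ is the graph with vertex set $\{v_1,\dots,v_n,u_1,\dots,u_n,w\}$ ($2n+1$ distinct vertices) whose edges are: all edges of $G$; the edges $wu_i$ for $1\le i\le n$; and, for each edge $v_iv_j$ of $G$, the edges $u_iv_j$ and $v_iu_j$. *)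

theory Defs
  imports "Graph_Theory.Pair_Digraph" "Graph_Theory.Digraph_Component"
begin

(* A finite simple undirected graph is a pair_graph: a finite, loop-free, symmetric relation
   parcs G on the vertex set pverts G, so that an edge {u, v} is the pair of arcs (u, v), (v, u).
   The constant connected of Digraph_Component requires a nonempty vertex set. *)

definition dominating_set :: "'a pair_pre_digraph \<Rightarrow> 'a set \<Rightarrow> bool" where
  "dominating_set G S \<longleftrightarrow>
     S \<subseteq> pverts G \<and> (\<forall>u \<in> pverts G - S. \<exists>v \<in> S. (u, v) \<in> parcs G)"

definition secure_dominating_set :: "'a pair_pre_digraph \<Rightarrow> 'a set \<Rightarrow> bool" where
  "secure_dominating_set G S \<longleftrightarrow>
     dominating_set G S \<and>
     (\<forall>u \<in> pverts G - S. \<exists>v \<in> S. (u, v) \<in> parcs G \<and> dominating_set G ((S - {v}) \<union> {u}))"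

(* On a finite graph the minimum is over a finite set, nonempty since pverts G is itself secure
   dominating. *)
definition secure_domination_number :: "'a pair_pre_digraph \<Rightarrow> nat" where
  "secure_domination_number G = Min (card ` {S. secure_dominating_set G S})"

(* Orig v_i, Copy v_i and Apex stand for v_i, u_i and w. *)
datatype 'a mycielski_vertex = Orig 'a | Copy 'a | Apex

definition mycielskian :: "'a pair_pre_digraph \<Rightarrow> 'a mycielski_vertex pair_pre_digraph" where
  "mycielskian G =
     \<lparr> pverts = Orig ` pverts G \<union> Copy ` pverts G \<union> {Apex},
       parcs = {(Orig x, Orig y) | x y. (x, y) \<in> parcs G}
             \<union> {(Copy x, Orig y) | x y. (x, y) \<in> parcs G}
             \<union> {(Orig x, Copy y) | x y. (x, y) \<in> parcs G}
             \<union> {(Apex, Copy x) | x. x \<in> pverts G}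
             \<union> {(Copy x, Apex) | x. x \<in> pverts G} \<rparr>"

lemma pair_graph_mycielskian:
  assumes "pair_graph G"
  shows "pair_graph (mycielskian G)"
proof -
  interpret pair_graph G by fact
  have fin: "finite (pverts (mycielskian G))"
    by (simp add: mycielskian_def)
  have sub: "parcs (mycielskian G) \<subseteq> pverts (mycielskian G) \<times> pverts (mycielskian G)"
    by (auto simp: mycielskian_def dest: wellformed')
  have finarcs: "finite (parcs (mycielskian G))"
    using finite_subset[OF sub] fin by simp
  have "sym (parcs (mycielskian G))"
    by (auto simp: sym_def mycielskian_def intro: arcs_symmetric)
  moreover have "fst e \<noteq> snd e" if "e \<in> parcs (mycielskian G)" for e
    using that by (auto simp: mycielskian_def dest: no_loops')
  ultimately show ?thesis
    using fin finarcs sub by unfold_locales (auto simp: symmetric_def)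
qed

lemma secure_dominating_set_pverts: "secure_dominating_set G (pverts G)"
  by (simp add: secure_dominating_set_def dominating_set_def)

lemma finite_secure_dominating_sets:
  assumes "finite (pverts G)"
  shows "finite {S. secure_dominating_set G S}"
  by (rule finite_subset[of _ "Pow (pverts G)"])
     (auto simp: assms secure_dominating_set_def dominating_set_def)

end

theory Submission
  imports Defs
begin

text \<open>
  For \<open>n \<ge> 3\<close> the star \<open>K\<^sub>1\<^sub>,\<^sub>n\<close> has secure domination number \<open>n\<close>, whereas its Mycielskian has
  secure domination number \<open>3\<close>; hence \<open>n = k + 3\<close> gives the difference \<open>k\<close>.

  In the star itself, a missing leaf can only be defended by the centre; once the centre has moved
  there, every other leaf must have been in the set already, so the set has at least as many
  elements as there are leaves. In the Mycielskian the leaves have a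
  second common neighbour, the copy of the centre, so that one of the two can move to a leaf while
  the other keeps dominating the leaves. Together with the apex, which looks after the copies,
  these two vertices form a secure dominating set. Two vertices are not enough: a dominating set
  with at most two elements contains the centre, so the centre is not free to defend a leaf; hence
  the copy of the centre does, and then the apex loses its only neighbour in the set.
\<close>

definition star :: "nat \<Rightarrow> nat pair_pre_digraph" where
  "star n = \<lparr> pverts = {0..n}, parcs = {0} \<times> {1..n} \<union> {1..n} \<times> {0} \<rparr>"

lemma pverts_star [simp]: "pverts (star n) = {0..n}"
  by (simp add: star_def)

lemma parcs_star [simp]:
  "(u, v) \<in> parcs (star n) \<longleftrightarrow> u = 0 \<and> 1 \<le> v \<and> v \<le> n \<or> v = 0 \<and> 1 \<le> u \<and> u \<le> n"
  by (auto simp: star_def)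

lemma pair_graph_star: "pair_graph (star n)"
proof
  show "finite (parcs (star n))"
    by (simp add: star_def)
  show "symmetric (with_proj (star n))"
    by (auto simp: symmetric_def sym_def)
qed (auto simp: star_def)

lemma connected_star: "Digraph_Component.connected (with_proj (star n))"
proof -
  interpret pair_graph "star n"
    by (rule pair_graph_star)
  have to_centre: "u \<rightarrow>\<^sup>*\<^bsub>with_proj (star n)\<^esub> 0" and from_centre: "0 \<rightarrow>\<^sup>*\<^bsub>with_proj (star n)\<^esub> u"
    if "u \<in> {0..n}" for u
    using that by (cases "u = 0"; force intro: reachable_adjI)+
  show ?thesis
  proof (rule connectedI)
    fix u v assume "u \<in> pverts (star n)" "v \<in> pverts (star n)"
    then have "u \<rightarrow>\<^sup>*\<^bsub>with_proj (star n)\<^esub> v"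
      using reachable_trans[OF to_centre from_centre] by simp
    then show "u \<rightarrow>\<^sup>*\<^bsub>with_proj (mk_symmetric (with_proj (star n)))\<^esub> v"
      by (rule reachable_mk_symmetricI)
  qed simp
qed

lemma secure_domination_number_eqI:
  assumes "finite (pverts G)" and "secure_dominating_set G S" and "card S = m"
    and "\<And>T. secure_dominating_set G T \<Longrightarrow> m \<le> card T"
  shows "secure_domination_number G = m"
  unfolding secure_domination_number_def
  using assms by (intro Min_eqI) (auto intro: finite_secure_dominating_sets)

lemma finite_dominating_set:
  assumes "dominating_set G S" and "finite (pverts G)"
  shows "finite S"
  using assms by (auto simp: dominating_set_def intro: finite_subset[of S "pverts G"])

lemma dominating_setD:
  assumes "dominating_set G S" and "u \<in> pverts G"
  shows "u \<in> S \<or> (\<exists>v \<in> S. (u, v) \<in> parcs G)"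
  using assms by (auto simp: dominating_set_def)

lemma secure_dominating_setE:
  assumes "secure_dominating_set G S" and "u \<in> pverts G" and "u \<notin> S"
  obtains v where "v \<in> S" and "(u, v) \<in> parcs G" and "dominating_set G ((S - {v}) \<union> {u})"
  using assms unfolding secure_dominating_set_def by blast

section \<open>Secure domination in stars\<close>

lemma leaves_subset_dominating_set_star:
  assumes "dominating_set (star n) S" and "0 \<notin> S"
  shows "{1..n} \<subseteq> S"
proof
  fix i assume "i \<in> {1..n}"
  then show "i \<in> S"
    using dominating_setD[OF assms(1), of i] assms(2) by auto
qed

lemma secure_dominating_set_star_leaves:
  assumes "1 \<le> n"
  shows "secure_dominating_set (star n) {1..n}"
  unfolding secure_dominating_set_def
proof (intro conjI ballI)
  show "dominating_set (star n) {1..n}"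
    unfolding dominating_set_def
  proof (intro conjI ballI)
    fix u assume "u \<in> pverts (star n) - {1..n}"
    with assms show "\<exists>v \<in> {1..n}. (u, v) \<in> parcs (star n)"
      by (intro bexI[of _ 1]) auto
  qed auto
  fix u assume "u \<in> pverts (star n) - {1..n}"
  then have "u = 0"
    by auto
  have "dominating_set (star n) ({1..n} - {1} \<union> {0})"
    by (auto simp: dominating_set_def)
  with assms \<open>u = 0\<close> show "\<exists>v \<in> {1..n}. (u, v) \<in> parcs (star n) \<and>
      dominating_set (star n) ({1..n} - {v} \<union> {u})"
    by (intro bexI[of _ 1]) auto
qed

text \<open>
  When the centre moves to a leaf outside the set, the size of the set does not change, and the
  new set, which omits the centre, contains all the leaves.
\<close>

lemma card_secure_dominating_set_star:
  assumes S: "secure_dominating_set (star n) S"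
  shows "n \<le> card S"
proof -
  have fin: "finite S"
    using S finite_dominating_set[of "star n" S] by (simp add: secure_dominating_set_def)
  show ?thesis
  proof (cases "{1..n} \<subseteq> S")
    case True
    with fin show ?thesis
      using card_mono[of S "{1..n}"] by simp
  next
    case False
    then obtain i where i: "i \<in> {1..n}" "i \<notin> S"
      by blast
    obtain v where v: "v \<in> S" "(i, v) \<in> parcs (star n)"
      and dom: "dominating_set (star n) ((S - {v}) \<union> {i})"
      using secure_dominating_setE[OF S, of i] i by auto
    from v i have "v = 0"
      by auto
    with dom i have "{1..n} \<subseteq> (S - {0}) \<union> {i}"
      by (intro leaves_subset_dominating_set_star) auto
    then have "card {1..n} \<le> card ((S - {0}) \<union> {i})"
      by (rule card_mono[rotated]) (simp add: fin)
    also have "\<dots> = card S"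
      using card.remove[OF fin, of 0] fin i v \<open>v = 0\<close> by simp
    finally show ?thesis
      by simp
  qed
qed

lemma secure_domination_number_star:
  assumes "1 \<le> n"
  shows "secure_domination_number (star n) = n"
  using assms
  by (intro secure_domination_number_eqI[OF _ secure_dominating_set_star_leaves])
     (auto intro: card_secure_dominating_set_star)

section \<open>Secure domination in Mycielskians of stars\<close>

lemma pverts_mycielskian [simp]:
  "Orig x \<in> pverts (mycielskian G) \<longleftrightarrow> x \<in> pverts G"
  "Copy x \<in> pverts (mycielskian G) \<longleftrightarrow> x \<in> pverts G"
  "Apex \<in> pverts (mycielskian G)"
  by (auto simp: mycielskian_def)

lemma parcs_mycielskian [simp]:
  "(Orig x, Orig y) \<in> parcs (mycielskian G) \<longleftrightarrow> (x, y) \<in> parcs G"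
  "(Orig x, Copy y) \<in> parcs (mycielskian G) \<longleftrightarrow> (x, y) \<in> parcs G"
  "(Copy x, Orig y) \<in> parcs (mycielskian G) \<longleftrightarrow> (x, y) \<in> parcs G"
  "(Apex, Copy y) \<in> parcs (mycielskian G) \<longleftrightarrow> y \<in> pverts G"
  "(Copy x, Apex) \<in> parcs (mycielskian G) \<longleftrightarrow> x \<in> pverts G"
  "(Copy x, Copy y) \<notin> parcs (mycielskian G)"
  "(Orig x, Apex) \<notin> parcs (mycielskian G)"
  "(Apex, Orig y) \<notin> parcs (mycielskian G)"
  "(Apex, Apex) \<notin> parcs (mycielskian G)"
  by (auto simp: mycielskian_def)

lemma finite_pverts_mycielskian: "finite (pverts G) \<Longrightarrow> finite (pverts (mycielskian G))"
  by (simp add: mycielskian_def)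

text \<open>
  The four membership conditions take care of the leaves, of the copies of the leaves, of the copy
  of the centre together with the apex, which are adjacent, and of the centre, in this order.
\<close>

lemma dominating_set_mycielskian_star:
  assumes "S \<subseteq> pverts (mycielskian (star n))"
    and leaves: "Orig 0 \<in> S \<or> Copy 0 \<in> S"
    and copies: "Orig 0 \<in> S \<or> Apex \<in> S"
    and copy_of_centre_and_apex: "Copy 0 \<in> S \<or> Apex \<in> S"
    and centre: "Orig 0 \<in> S \<or> (\<exists>i \<in> {1..n}. Orig i \<in> S \<or> Copy i \<in> S)"
  shows "dominating_set (mycielskian (star n)) S"
  unfolding dominating_set_def
proof (intro conjI ballI)
  show "S \<subseteq> pverts (mycielskian (star n))"
    by fact
  fix u assume u: "u \<in> pverts (mycielskian (star n)) - S"
  show "\<exists>v \<in> S. (u, v) \<in> parcs (mycielskian (star n))"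
  proof (cases u)
    case (Orig i)
    then show ?thesis
      using u leaves centre by (cases "i = 0") force+
  next
    case (Copy i)
    then show ?thesis
      using u copies copy_of_centre_and_apex by (cases "i = 0") force+
  next
    case Apex
    then show ?thesis
      using u copy_of_centre_and_apex by force
  qed
qed

text \<open>
  The copy of the centre defends the leaves and the centre defends their copies. Whichever of the
  two moves, the other one keeps dominating the leaves and the apex dominates the copies; a centre
  that has moved to the copy of a leaf is dominated from there.
\<close>

lemma secure_dominating_set_mycielskian_star:
  "secure_dominating_set (mycielskian (star n)) {Orig 0, Copy 0, Apex}"
  unfolding secure_dominating_set_def
proof (intro conjI ballI)
  show "dominating_set (mycielskian (star n)) {Orig 0, Copy 0, Apex}"
    by (rule dominating_set_mycielskian_star) auto
  fix u assume u: "u \<in> pverts (mycielskian (star n)) - {Orig 0, Copy 0, Apex}"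
  let ?defends = "\<lambda>v. (u, v) \<in> parcs (mycielskian (star n)) \<and>
    dominating_set (mycielskian (star n)) ({Orig 0, Copy 0, Apex} - {v} \<union> {u})"
  show "\<exists>v \<in> {Orig 0, Copy 0, Apex}. ?defends v"
  proof (cases u)
    case (Orig i)
    with u have "?defends (Copy 0)"
      by (auto intro!: dominating_set_mycielskian_star)
    then show ?thesis
      by blast
  next
    case (Copy i)
    with u have "?defends (Orig 0)"
      by (auto intro!: dominating_set_mycielskian_star)
    then show ?thesis
      by blast
  next
    case Apex
    with u show ?thesis
      by simp
  qed
qed

text \<open>
  If the centre is not in the set, then the leaves can only be dominated by the copy of the centre
  and the copies of the leaves only by the apex, as there are more than two of each; the third
  element is needed to dominate the centre.
\<close>

lemma centre_in_dominating_set_mycielskian_star: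
  assumes S: "dominating_set (mycielskian (star n)) S" and "card S \<le> 2" and "3 \<le> n"
  shows "Orig 0 \<in> S"
proof (rule ccontr)
  assume no_centre: "Orig 0 \<notin> S"
  have fin: "finite S"
    using S by (rule finite_dominating_set) (simp add: finite_pverts_mycielskian)
  have few: False if "{x, y, z} \<subseteq> S" "x \<noteq> y" "x \<noteq> z" "y \<noteq> z" for x y z
    using card_mono[OF fin that(1)] that(2-4) \<open>card S \<le> 2\<close> by simp
  have leaf: "Orig i \<in> S \<or> Copy 0 \<in> S" if i: "i \<in> {1..n}" for i
  proof -
    obtain v where "v = Orig i \<or> (Orig i, v) \<in> parcs (mycielskian (star n))" "v \<in> S"
      using dominating_setD[OF S, of "Orig i"] i by auto
    with no_centre i show ?thesis
      by (cases v) auto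
  qed
  have copy: "Copy i \<in> S \<or> Apex \<in> S" if i: "i \<in> {1..n}" for i
  proof -
    obtain v where "v = Copy i \<or> (Copy i, v) \<in> parcs (mycielskian (star n))" "v \<in> S"
      using dominating_setD[OF S, of "Copy i"] i by auto
    with no_centre i show ?thesis
      by (cases v) auto
  qed
  have "Copy 0 \<in> S"
    using few[of "Orig 1" "Orig 2" "Orig 3"] leaf[of 1] leaf[of 2] leaf[of 3] \<open>3 \<le> n\<close> by auto
  moreover have "Apex \<in> S"
    using few[of "Copy 1" "Copy 2" "Copy 3"] copy[of 1] copy[of 2] copy[of 3] \<open>3 \<le> n\<close> by auto
  moreover obtain y where "y \<in> S" "(Orig 0, y) \<in> parcs (mycielskian (star n))"
    using dominating_setD[OF S, of "Orig 0"] no_centre by auto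
  then have "y \<in> S" "y \<noteq> Copy 0" "y \<noteq> Apex"
    by auto
  ultimately show False
    using few[of "Copy 0" Apex y] by auto
qed

lemma card_secure_dominating_set_mycielskian_star:
  assumes S: "secure_dominating_set (mycielskian (star n)) S" and "3 \<le> n"
  shows "3 \<le> card S"
proof (rule ccontr)
  assume "\<not> 3 \<le> card S"
  then have small: "card S \<le> 2"
    by simp
  have dom: "dominating_set (mycielskian (star n)) S"
    using S by (simp add: secure_dominating_set_def)
  then have fin: "finite S"
    by (rule finite_dominating_set) (simp add: finite_pverts_mycielskian)
  have centre: "Orig 0 \<in> S"
    using dom small \<open>3 \<le> n\<close> by (rule centre_in_dominating_set_mycielskian_star)
  obtain a where a: "a \<in> S" "a = Apex \<or> (Apex, a) \<in> parcs (mycielskian (star n))"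
    using dominating_setD[OF dom, of Apex] by auto
  then have a_not_Orig: "a \<noteq> Orig i" for i
    by auto
  then have "card {Orig 0, a} = 2"
    by (metis card_2_iff)
  with centre a fin small have S_eq: "S = {Orig 0, a}"
    using card_seteq[of S "{Orig 0, a}"] by simp
  have "Orig 1 \<in> pverts (mycielskian (star n))" "Orig 1 \<notin> S"
    using S_eq a_not_Orig \<open>3 \<le> n\<close> by auto
  with S obtain v where v: "v \<in> S" "(Orig 1, v) \<in> parcs (mycielskian (star n))"
    and moved: "dominating_set (mycielskian (star n)) ((S - {v}) \<union> {Orig 1})"
    by (rule secure_dominating_setE)
  have "card ((S - {v}) \<union> {Orig 1}) \<le> 2"
    using S_eq v by (auto simp: card_insert_if)
  with moved have "Orig 0 \<in> (S - {v}) \<union> {Orig 1}"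
    using \<open>3 \<le> n\<close> by (rule centre_in_dominating_set_mycielskian_star)
  with v S_eq have "(S - {v}) \<union> {Orig 1} = {Orig 0, Orig 1}"
    by auto
  with moved have "dominating_set (mycielskian (star n)) {Orig 0, Orig 1}"
    by simp
  from dominating_setD[OF this, of Apex] show False
    by simp
qed

lemma secure_domination_number_mycielskian_star:
  assumes "3 \<le> n"
  shows "secure_domination_number (mycielskian (star n)) = 3"
  using assms
  by (intro secure_domination_number_eqI[OF _ secure_dominating_set_mycielskian_star])
     (auto simp: finite_pverts_mycielskian intro: card_secure_dominating_set_mycielskian_star)

theorem proposition4p2:
  shows "\<forall>k::nat. \<exists>G :: nat pair_pre_digraph.
           pair_graph G \<and> Digraph_Component.connected (with_proj G) \<and>
           int (secure_domination_number G) - int (secure_domination_number (mycielskian G)) = int k"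
proof
  fix k :: nat
  have "int (secure_domination_number (star (k + 3)))
          - int (secure_domination_number (mycielskian (star (k + 3)))) = int k"
    by (simp add: secure_domination_number_star secure_domination_number_mycielskian_star)
  then show "\<exists>G :: nat pair_pre_digraph.
           pair_graph G \<and> Digraph_Component.connected (with_proj G) \<and>
           int (secure_domination_number G) - int (secure_domination_number (mycielskian G)) = int k"
    by (intro exI[of _ "star (k + 3)"] conjI pair_graph_star connected_star)
qed

end
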